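(* Let $N$ be a positive integer and $p$ a prime such that $p\mid N$, $p^2\nmid N$, and $p^j\equiv -1\pmod{N/p}$ for some integer $j$. Then $\mathbb{Z}_N$ does not have any pair of subsets $S,T\subseteq\mathbb{Z}_N$ that are both primitive and formally dual to each other.
   Context: $\mathbb{Z}_N$ is the cyclic group modulo $N$, $\zeta_N=e^{2\pi i/N}$. A subset $T\subseteq\mathbb{Z}_N$ is primitive if it is not contained in any coset of a proper subgroup of $\mathbb{Z}_N$. For $T\subseteq\mathbb{Z}_N$ let $\nu_T(y)=\#\{(t,t')\in T\times T: t-t'=y\}$. Two nonempty subsets $S,T\subseteq\mathbb{Z}_N$ are formally dual if for every $y\in\mathbb{Z}_N$, $\frac{1}{|S|^2}\left|\sum_{x\in S}\zeta_N^{xy}\right|^2=\frac{1}{|T|}\nu_T(y)$. *)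

theory Defs
  imports Complex_Main "HOL-Algebra.Elementary_Groups" "HOL-Number_Theory.Modular_Inverse"
begin

text \<open>
  \<open>\<int>\<^sub>N\<close> is the library group \<^term>\<open>integer_mod_group N\<close>, with carrier \<open>{0..<int N}\<close> for \<open>N > 0\<close>.
\<close>

definition primitive_subset :: "nat \<Rightarrow> int set \<Rightarrow> bool" where
  "primitive_subset N T \<longleftrightarrow>
     T \<subseteq> carrier (integer_mod_group N) \<and>
     (\<forall>H. subgroup H (integer_mod_group N) \<and> H \<noteq> carrier (integer_mod_group N) \<longrightarrow>
        (\<forall>C \<in> rcosets\<^bsub>integer_mod_group N\<^esub> H. \<not> T \<subseteq> C))"

definition diff_count :: "nat \<Rightarrow> int set \<Rightarrow> int \<Rightarrow> nat" where
  "diff_count N T y =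
     card {(t, t') \<in> T \<times> T. t \<otimes>\<^bsub>integer_mod_group N\<^esub> inv\<^bsub>integer_mod_group N\<^esub> t' = y}"

definition zeta :: "nat \<Rightarrow> complex" where
  "zeta N = exp (2 * of_real pi * \<i> / of_nat N)"

definition formally_dual :: "nat \<Rightarrow> int set \<Rightarrow> int set \<Rightarrow> bool" where
  "formally_dual N S T \<longleftrightarrow>
     S \<subseteq> carrier (integer_mod_group N) \<and> S \<noteq> {} \<and>
     T \<subseteq> carrier (integer_mod_group N) \<and> T \<noteq> {} \<and>
     (\<forall>y \<in> carrier (integer_mod_group N).
        1 / (real (card S))\<^sup>2 * (cmod (\<Sum>x\<in>S. zeta N powi (x * y)))\<^sup>2 =
        1 / real (card T) * real (diff_count N T y))"

text \<open>
  An integer representing \<open>a\<^sup>j\<close> modulo \<open>m\<close> for an integer exponent \<open>j\<close>, where a negative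
  exponent refers to the inverse of \<open>a\<close> modulo \<open>m\<close>; it is meant for \<open>a\<close> coprime to \<open>m\<close>.
\<close>
definition mod_int_power :: "int \<Rightarrow> int \<Rightarrow> int \<Rightarrow> int" where
  "mod_int_power m a j =
     (if j \<ge> 0 then a ^ nat j else modular_inverse m a ^ nat (- j))"

end

theory Submission
  imports Defs "HOL-Analysis.Complex_Transcendental" "HOL-Number_Theory.Residues"
begin

text \<open>
  Fourier inversion shows that formal duality is symmetric and that \<open>|S| |T| = N\<close>; as \<open>p\<close> divides \<open>N\<close>
  exactly once, we may assume \<open>p\<close> divides \<open>|S|\<close> but not \<open>|T|\<close>. Then \<open>p\<^sup>2\<close> divides the squared absolute
  value of every character sum \<open>X\<close> of \<open>S\<close> in \<open>\<int>[\<zeta>]\<close>, where \<open>\<zeta> = \<zeta>\<^sub>N\<close>. Put \<open>m = N / p\<close> and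
  \<open>\<pi> = 1 - \<zeta>\<^sup>m\<close>. Modulo \<open>\<pi>\<close>, complex conjugation is a power of the Frobenius map because \<open>- 1\<close> is a
  power of \<open>p\<close> modulo \<open>m\<close>; so powers of \<open>\<pi>\<close> dividing the squared absolute value can be split off \<open>X\<close>
  one at a time, whence \<open>p\<close> divides \<open>X\<close>. By Fourier inversion, \<open>N\<close> times the difference of the
  indicator function of \<open>S\<close> and its translate by \<open>m\<close> is divisible by \<open>p \<pi>\<close>, which forces \<open>S\<close> to be
  invariant under translation by \<open>m\<close>. Hence \<open>X\<close> vanishes at all \<open>y\<close> not divisible by \<open>p\<close>, that is, all
  differences in \<open>T\<close> are divisible by \<open>p\<close>, and \<open>T\<close> is not primitive.
\<close>

subsection \<open>Divisibility in integral extensions generated by one element\<close>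

text \<open>The subring Z[w]. The inductive form allows proofs over generators, sums and products,
  as for the Frobenius congruence below.\<close>

inductive_set int_adjoin :: "'a::comm_ring_1 \<Rightarrow> 'a set" for w :: 'a where
  int_adjoin_of_int: "of_int a \<in> int_adjoin w"
| int_adjoin_generator: "w \<in> int_adjoin w"
| int_adjoin_add: "x \<in> int_adjoin w \<Longrightarrow> y \<in> int_adjoin w \<Longrightarrow> x + y \<in> int_adjoin w"
| int_adjoin_mult: "x \<in> int_adjoin w \<Longrightarrow> y \<in> int_adjoin w \<Longrightarrow> x * y \<in> int_adjoin w"

text \<open>The quotient has to lie in Z[w]: plain \<open>dvd\<close> in the field of complex
  numbers is trivial for every nonzero divisor.\<close>

definition adjoin_dvd :: "'a::comm_ring_1 \<Rightarrow> 'a \<Rightarrow> 'a \<Rightarrow> bool" where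
  "adjoin_dvd w x y \<longleftrightarrow> (\<exists>z\<in>int_adjoin w. y = x * z)"

lemma int_adjoin_0: "0 \<in> int_adjoin w"
  using int_adjoin_of_int[of 0 w] by simp

lemma int_adjoin_1: "1 \<in> int_adjoin w"
  using int_adjoin_of_int[of 1 w] by simp

lemma int_adjoin_of_nat: "of_nat k \<in> int_adjoin w"
  using int_adjoin_of_int[of "int k" w] by simp

lemma int_adjoin_uminus: "x \<in> int_adjoin w \<Longrightarrow> - x \<in> int_adjoin w"
  using int_adjoin_mult[OF int_adjoin_of_int[of "-1"], of x w] by simp

lemma int_adjoin_diff: "x \<in> int_adjoin w \<Longrightarrow> y \<in> int_adjoin w \<Longrightarrow> x - y \<in> int_adjoin w"
  using int_adjoin_add[OF _ int_adjoin_uminus, of x w y] by simp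

lemma int_adjoin_power: "x \<in> int_adjoin w \<Longrightarrow> x ^ k \<in> int_adjoin w"
  by (induction k) (auto intro: int_adjoin_1 int_adjoin_mult)

lemma int_adjoin_sum: "(\<And>i. i \<in> I \<Longrightarrow> f i \<in> int_adjoin w) \<Longrightarrow> sum f I \<in> int_adjoin w"
  by (induction I rule: infinite_finite_induct) (auto intro: int_adjoin_0 int_adjoin_add)

lemmas int_adjoin_closed =
  int_adjoin_of_int int_adjoin_generator int_adjoin_add int_adjoin_mult int_adjoin_0 int_adjoin_1
  int_adjoin_of_nat int_adjoin_uminus int_adjoin_diff int_adjoin_power int_adjoin_sum

lemma adjoin_dvd_refl: "adjoin_dvd w x x"
  unfolding adjoin_dvd_def using int_adjoin_1 by (intro bexI[of _ 1]) auto

lemma adjoin_dvd_0: "adjoin_dvd w x 0"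
  unfolding adjoin_dvd_def using int_adjoin_0 by (intro bexI[of _ 0]) auto

lemma adjoin_dvd_add: "adjoin_dvd w x a \<Longrightarrow> adjoin_dvd w x b \<Longrightarrow> adjoin_dvd w x (a + b)"
  unfolding adjoin_dvd_def by (auto simp flip: distrib_left intro: int_adjoin_add)

lemma adjoin_dvd_diff: "adjoin_dvd w x a \<Longrightarrow> adjoin_dvd w x b \<Longrightarrow> adjoin_dvd w x (a - b)"
  unfolding adjoin_dvd_def by (auto simp flip: right_diff_distrib intro: int_adjoin_diff)

lemma adjoin_dvd_mult_left: "adjoin_dvd w x a \<Longrightarrow> b \<in> int_adjoin w \<Longrightarrow> adjoin_dvd w x (b * a)"
  unfolding adjoin_dvd_def by (auto simp: mult.left_commute[of b] intro: int_adjoin_mult)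

lemma adjoin_dvd_mult_right: "adjoin_dvd w x a \<Longrightarrow> b \<in> int_adjoin w \<Longrightarrow> adjoin_dvd w x (a * b)"
  using adjoin_dvd_mult_left[of w x a b] by (simp add: mult.commute)

lemma adjoin_dvd_trans: "adjoin_dvd w x y \<Longrightarrow> adjoin_dvd w y z \<Longrightarrow> adjoin_dvd w x z"
  unfolding adjoin_dvd_def by (auto simp: mult.assoc intro: int_adjoin_mult)

lemma adjoin_dvd_sum: "(\<And>i. i \<in> I \<Longrightarrow> adjoin_dvd w x (f i)) \<Longrightarrow> adjoin_dvd w x (sum f I)"
  by (induction I rule: infinite_finite_induct) (auto intro: adjoin_dvd_0 adjoin_dvd_add)

lemma adjoin_dvd_mult_mono:
  "adjoin_dvd w x a \<Longrightarrow> adjoin_dvd w y b \<Longrightarrow> adjoin_dvd w (x * y) (a * b)"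
  unfolding adjoin_dvd_def
proof (elim bexE)
  fix u v assume "u \<in> int_adjoin w" "v \<in> int_adjoin w" "a = x * u" "b = y * v"
  then show "\<exists>z\<in>int_adjoin w. a * b = x * y * z"
    by (intro bexI[of _ "u * v"] int_adjoin_mult) (auto simp: mult_ac)
qed

lemma adjoin_dvd_power: "adjoin_dvd w x a \<Longrightarrow> adjoin_dvd w (x ^ k) (a ^ k)"
  by (induction k) (auto intro: adjoin_dvd_refl adjoin_dvd_mult_mono)

lemma adjoin_dvd_of_int: "a dvd b \<Longrightarrow> adjoin_dvd w (of_int a) (of_int b)"
  unfolding adjoin_dvd_def by (auto elim!: dvdE intro: int_adjoin_of_int)

text \<open>Serves two purposes: to raise congruences modulo x to powers and, with x = a - b, to
  split a - b off a^k - b^k.\<close>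

lemma adjoin_dvd_diff_power:
  assumes "adjoin_dvd w x (a - b)" "a \<in> int_adjoin w" "b \<in> int_adjoin w"
  shows "adjoin_dvd w x (a ^ k - b ^ k)"
proof (induction k)
  case (Suc k)
  have "a ^ Suc k - b ^ Suc k = a * (a ^ k - b ^ k) + (a - b) * b ^ k"
    by (simp add: algebra_simps)
  then show ?case
    using adjoin_dvd_add[OF adjoin_dvd_mult_left[OF Suc] adjoin_dvd_mult_right[OF assms(1)]] assms
    by (simp add: int_adjoin_power)
qed (simp add: adjoin_dvd_0)

lemma adjoin_dvd_diff_trans:
  "adjoin_dvd w x (a - b) \<Longrightarrow> adjoin_dvd w x (b - c) \<Longrightarrow> adjoin_dvd w x (a - c)"
  using adjoin_dvd_add[of w x "a - b" "b - c"] by simp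

text \<open>As x divides p, the middle binomial coefficients vanish modulo x. This settles exponent
  p; the induction raises the congruence for p^k to the p-th power.\<close>

lemma adjoin_dvd_frobenius_add:
  assumes "prime p" "adjoin_dvd w x (of_nat p)" "a \<in> int_adjoin w" "b \<in> int_adjoin w"
  shows "adjoin_dvd w x ((a + b) ^ p ^ k - (a ^ p ^ k + b ^ p ^ k))"
proof (induction k)
  case (Suc k)
  have prime_case: "adjoin_dvd w x ((a + b) ^ p - (a ^ p + b ^ p))"
    if a: "a \<in> int_adjoin w" and b: "b \<in> int_adjoin w" for a b
  proof -
    define f where "f i = of_nat (p choose i) * a ^ i * b ^ (p - i)" for i
    have "p > 0"
      using assms(1) prime_gt_0_nat by blast
    have "(a + b) ^ p = sum f {..p}"
      by (simp add: binomial_ring f_def)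
    also have "{..p} = insert 0 (insert p {0<..<p})"
      using \<open>p > 0\<close> by auto
    also have "sum f \<dots> = b ^ p + (a ^ p + sum f {0<..<p})"
      using \<open>p > 0\<close> by (simp add: f_def)
    finally have eq: "(a + b) ^ p - (a ^ p + b ^ p) = sum f {0<..<p}"
      by simp
    have "adjoin_dvd w x (f i)" if "i \<in> {0<..<p}" for i
    proof -
      have "p dvd (p choose i)"
        using that assms(1) by (intro dvd_choose_prime) auto
      then have "adjoin_dvd w (of_nat p) (of_nat (p choose i))"
        using adjoin_dvd_of_int[of "int p" "int (p choose i)" w] by simp
      then show ?thesis
        unfolding f_def using assms(2) a b
        by (intro adjoin_dvd_mult_right int_adjoin_power) (auto intro: adjoin_dvd_trans)
    qed
    then show ?thesis
      unfolding eq by (rule adjoin_dvd_sum)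
  qed
  have "adjoin_dvd w x (((a + b) ^ p ^ k) ^ p - (a ^ p ^ k + b ^ p ^ k) ^ p)"
    using Suc assms by (intro adjoin_dvd_diff_power) (auto intro: int_adjoin_closed)
  moreover have "adjoin_dvd w x ((a ^ p ^ k + b ^ p ^ k) ^ p - ((a ^ p ^ k) ^ p + (b ^ p ^ k) ^ p))"
    using assms by (intro prime_case) (auto intro: int_adjoin_closed)
  ultimately show ?case
    unfolding power_Suc2 power_mult by (rule adjoin_dvd_diff_trans)
qed (simp add: adjoin_dvd_0)

section \<open>Finite generation of Z[w] for a root of unity w, and p as a non-unit\<close>

lemma int_adjoin_root_of_unity_span:
  assumes "w ^ N = 1" "N > 0" "z \<in> int_adjoin w"
  shows "\<exists>c :: nat \<Rightarrow> int. z = (\<Sum>i<N. of_int (c i) * w ^ i)"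
proof -
  define M where "M = {z. \<exists>c :: nat \<Rightarrow> int. z = (\<Sum>i<N. of_int (c i) * w ^ i)}"
  have add: "x + y \<in> M" if "x \<in> M" "y \<in> M" for x y
  proof -
    from that obtain c d :: "nat \<Rightarrow> int" where
      "x = (\<Sum>i<N. of_int (c i) * w ^ i)" "y = (\<Sum>i<N. of_int (d i) * w ^ i)"
      by (auto simp: M_def)
    then have "x + y = (\<Sum>i<N. of_int (c i + d i) * w ^ i)"
      by (simp add: sum.distrib algebra_simps)
    then show ?thesis
      unfolding M_def by (intro CollectI exI[of _ "\<lambda>i. c i + d i"])
  qed
  have smult: "of_int a * x \<in> M" if "x \<in> M" for a x
  proof -
    from that obtain c :: "nat \<Rightarrow> int" where "x = (\<Sum>i<N. of_int (c i) * w ^ i)"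
      by (auto simp: M_def)
    then have "of_int a * x = (\<Sum>i<N. of_int (a * c i) * w ^ i)"
      by (simp add: sum_distrib_left algebra_simps)
    then show ?thesis
      unfolding M_def by (intro CollectI exI[of _ "\<lambda>i. a * c i"])
  qed
  have power: "w ^ k \<in> M" for k
  proof -
    have "w ^ k = w ^ (k mod N)"
      using assms(1) by (metis mod_mult_div_eq mult_1_right power_add power_mult power_one)
    also have "\<dots> = (\<Sum>i<N. if i = k mod N then w ^ i else 0)"
      using assms(2) by simp
    also have "\<dots> = (\<Sum>i<N. of_int (if i = k mod N then 1 else 0) * w ^ i)"
      by (intro sum.cong) auto
    finally show ?thesis
      unfolding M_def by (intro CollectI exI[of _ "\<lambda>i. if i = k mod N then 1 else 0"])
  qed
  have sum: "sum f I \<in> M" if "\<And>i. i \<in> I \<Longrightarrow> f i \<in> M" for f and I :: "nat set"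
    using that
  proof (induction I rule: infinite_finite_induct)
    case (insert i I)
    then show ?case by (auto intro: add)
  qed (use smult[OF power[of 0], of 0] in auto)
  \<comment> \<open>The extra factor \<open>w ^ k\<close> makes the induction pass through products:
    \<open>y * w ^ k\<close> is expanded first, then the hypothesis for x applies to each
    term.\<close>
  have "z * w ^ k \<in> M" for k
    using assms(3)
  proof (induction arbitrary: k)
    case (int_adjoin_generator)
    then show ?case
      using power[of "Suc k"] by simp
  next
    case (int_adjoin_mult x y)
    obtain c :: "nat \<Rightarrow> int" where "y * w ^ k = (\<Sum>i<N. of_int (c i) * w ^ i)"
      using int_adjoin_mult.IH(2)[of k] by (auto simp: M_def)
    then have "x * y * w ^ k = (\<Sum>i<N. of_int (c i) * (x * w ^ i))"
      by (simp add: sum_distrib_left mult.assoc mult.left_commute)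
    also have "\<dots> \<in> M"
      by (intro sum smult int_adjoin_mult.IH)
    finally show ?case .
  qed (auto simp: distrib_right intro: add smult power)
  from this[of 0] show ?thesis
    by (simp add: M_def)
qed

text \<open>
  Nakayama's argument: over the integers localised at \<open>p\<close>, the powers of \<open>w\<close> can be dropped one
  at a time from the generating family, until nothing is left to generate \<open>1\<close>.
\<close>
lemma prime_not_unit_int_adjoin:
  fixes w :: "'a::{idom, ring_char_0}"
  assumes "w ^ N = 1" "N > 0" "prime p"
  shows "\<not> adjoin_dvd w (of_nat p) 1"
proof
  assume "adjoin_dvd w (of_nat p) 1"
  then obtain v where v: "v \<in> int_adjoin w" "of_nat p * v = 1"
    by (auto simp: adjoin_dvd_def)
  \<comment> \<open>Up to a denominator u prime to p, the first n powers of w span Z[w]. The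
    induction runs downwards from n = N to n = 0.\<close>
  have "\<forall>z\<in>int_adjoin w. \<exists>u (c :: nat \<Rightarrow> int). coprime u (int p) \<and>
          of_int u * z = (\<Sum>i<n. of_int (c i) * w ^ i)" if "n \<le> N" for n
    using that
  proof (induction n rule: inc_induct)
    case base
    show ?case
    proof
      fix z assume "z \<in> int_adjoin w"
      then obtain c :: "nat \<Rightarrow> int" where "z = (\<Sum>i<N. of_int (c i) * w ^ i)"
        using int_adjoin_root_of_unity_span assms by blast
      then show "\<exists>u (c :: nat \<Rightarrow> int). coprime u (int p) \<and>
                   of_int u * z = (\<Sum>i<N. of_int (c i) * w ^ i)"
        by (intro exI[of _ 1] exI[of _ c]) auto
    qed
  next
    case (step n)
    have "v * w ^ n \<in> int_adjoin w"
      using v by (auto intro: int_adjoin_closed)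
    then obtain u c where u: "coprime u (int p)"
      and uc: "of_int u * (v * w ^ n) = (\<Sum>i<Suc n. of_int (c i) * w ^ i)"
      using step.IH by blast
    \<comment> \<open>Since v inverts p, \<open>w ^ n\<close> is p times a combination of lower
      powers and itself. Moving its own term to the left leaves the coefficient u - p c_n, still
      prime to p, so \<open>w ^ n\<close> can be eliminated.\<close>
    have "of_int u * w ^ n = of_int u * (of_nat p * v) * w ^ n"
      using v by simp
    also have "\<dots> = of_nat p * (of_int u * (v * w ^ n))"
      by (simp add: mult_ac)
    also have "\<dots> = of_nat p * (\<Sum>i<n. of_int (c i) * w ^ i) + of_nat p * of_int (c n) * w ^ n"
      unfolding uc by (simp add: algebra_simps)
    finally have eliminate:
      "of_int (u - int p * c n) * w ^ n = of_nat p * (\<Sum>i<n. of_int (c i) * w ^ i)"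
      by (simp add: algebra_simps)
    have coprime: "coprime (u - int p * c n) (int p)"
      by (rule cong_imp_coprime[OF _ u]) (simp add: cong_iff_dvd_diff)
    show ?case
    proof
      fix z assume "z \<in> int_adjoin w"
      then obtain u' d where u': "coprime u' (int p)"
        and ud: "of_int u' * z = (\<Sum>i<Suc n. of_int (d i) * w ^ i)"
        using step.IH by blast
      define e where "e i = (u - int p * c n) * d i + d n * (int p * c i)" for i
      have "of_int ((u - int p * c n) * u') * z = of_int (u - int p * c n) * (of_int u' * z)"
        by (simp only: of_int_mult mult.assoc)
      also have "\<dots> = of_int (u - int p * c n) * (\<Sum>i<n. of_int (d i) * w ^ i)
                      + of_int (d n) * (of_int (u - int p * c n) * w ^ n)"
        unfolding ud by (simp only: sum.lessThan_Suc distrib_left mult.left_commute)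
      also have "\<dots> = (\<Sum>i<n. of_int (e i) * w ^ i)"
        unfolding eliminate
        by (simp only: e_def sum_distrib_left of_int_add of_int_mult of_int_of_nat_eq distrib_right
            sum.distrib mult.assoc)
      finally have "of_int ((u - int p * c n) * u') * z = (\<Sum>i<n. of_int (e i) * w ^ i)" .
      moreover have "coprime ((u - int p * c n) * u') (int p)"
        using coprime u' by simp
      ultimately show "\<exists>u (c :: nat \<Rightarrow> int). coprime u (int p) \<and>
                         of_int u * z = (\<Sum>i<n. of_int (c i) * w ^ i)"
        by (intro exI conjI)
    qed
  qed
  \<comment> \<open>For n = 0 the sum is empty, so u = 0, although u is prime to p.\<close>
  from bspec[OF this[of 0] int_adjoin_1] obtain u
    where "coprime u (int p)" "of_int u * (1 :: 'a) = 0"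
    by auto
  then show False
    using assms(3) by auto
qed

subsection \<open>Roots of unity\<close>

lemma zeta_nonzero: "zeta N \<noteq> 0"
  by (simp add: zeta_def)

lemma zeta_powi_eq_1_iff:
  assumes "N > 0"
  shows "zeta N powi k = 1 \<longleftrightarrow> int N dvd k"
proof -
  have "zeta N powi k = exp (of_int k * (2 * of_real pi * \<i> / of_nat N))"
    by (simp add: zeta_def exp_power_int)
  also have "\<dots> = 1 \<longleftrightarrow> (\<exists>n::int. of_int k = (of_int (n * int N) :: real))"
    using assms by (auto simp: exp_eq_1 field_simps)
  also have "\<dots> \<longleftrightarrow> int N dvd k"
    unfolding of_int_eq_iff by (auto simp: dvd_def mult.commute)
  finally show ?thesis .
qed

lemma zeta_power_eq_1_iff: "N > 0 \<Longrightarrow> zeta N ^ k = 1 \<longleftrightarrow> N dvd k"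
  using zeta_powi_eq_1_iff[of N "int k"] by (simp add: power_int_of_nat)

lemma zeta_powi_add: "zeta N powi (a + b) = zeta N powi a * zeta N powi b"
  by (simp add: power_int_add zeta_nonzero)

lemma cnj_zeta_powi: "cnj (zeta N powi k) = zeta N powi (- k)"
proof -
  have "cmod (zeta N) = 1"
    by (simp add: zeta_def norm_exp_eq_Re)
  then have "zeta N * cnj (zeta N) = 1"
    using complex_norm_square[of "zeta N"] by simp
  then have "cnj (zeta N) = inverse (zeta N)"
    by (rule inverse_unique[symmetric])
  then show ?thesis
    by (simp add: power_int_minus power_int_inverse)
qed

lemma zeta_powi_cong:
  assumes "N > 0" "[a = b] (mod int N)"
  shows "zeta N powi a = zeta N powi b"
proof -
  have "zeta N powi (a - b) = 1"
    using assms by (simp add: zeta_powi_eq_1_iff cong_iff_dvd_diff)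
  then show ?thesis
    using zeta_powi_add[of N "a - b" b] by simp
qed

lemma zeta_powi_in_adjoin:
  assumes "N > 0"
  shows "zeta N powi k \<in> int_adjoin (zeta N)"
proof -
  \<comment> \<open>Reduction modulo N turns a possibly negative exponent into a natural
    one.\<close>
  define r where "r = nat (k mod int N)"
  have "zeta N powi k = zeta N powi int r"
    using assms by (intro zeta_powi_cong) (simp_all add: r_def cong_def)
  then show ?thesis
    by (simp add: int_adjoin_closed)
qed

lemma cnj_in_adjoin_zeta:
  assumes "N > 0" "z \<in> int_adjoin (zeta N)"
  shows "cnj z \<in> int_adjoin (zeta N)"
  using assms(2)
proof induction
  case int_adjoin_generator
  then show ?case
    using cnj_zeta_powi[of N 1] zeta_powi_in_adjoin[OF assms(1), of "-1"] by simp
qed (auto intro: int_adjoin_closed)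

text \<open>Orthogonality of characters, by a geometric series in the d-th power of
  \<open>zeta N\<close>.\<close>

lemma sum_zeta_powi:
  assumes "N > 0"
  shows "(\<Sum>y\<in>{0..<int N}. zeta N powi (y * d)) = (if int N dvd d then of_nat N else 0)"
proof -
  define g where "g = zeta N powi d"
  have "(\<Sum>y\<in>{0..<int N}. zeta N powi (y * d)) = (\<Sum>y\<in>int ` {0..<N}. zeta N powi (y * d))"
    by (simp add: image_int_atLeastLessThan)
  also have "\<dots> = (\<Sum>k\<in>{0..<N}. zeta N powi (int k * d))"
    by (simp add: sum.reindex)
  also have "\<dots> = (\<Sum>k<N. g ^ k)"
    by (simp add: g_def atLeast0LessThan mult.commute[of _ d] power_int_mult power_int_of_nat)
  also have "\<dots> = (if int N dvd d then of_nat N else 0)"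
  proof (cases "int N dvd d")
    case True
    then have "g = 1"
      using assms by (simp add: g_def zeta_powi_eq_1_iff)
    then show ?thesis
      using True by simp
  next
    case False
    have "g ^ N = zeta N powi (d * int N)"
      by (simp add: g_def power_int_mult power_int_of_nat)
    also have "\<dots> = 1"
      using assms by (simp add: zeta_powi_eq_1_iff)
    finally show ?thesis
      using False assms by (simp add: g_def zeta_powi_eq_1_iff geometric_sum)
  qed
  finally show ?thesis .
qed

subsection \<open>A self-conjugate prime in a cyclotomic ring\<close>

text \<open>The arithmetic of the theorem with m = N/p, the integer exponent j being replaced by a
  positive natural n with p^n congruent to -1 modulo m.\<close>

locale self_conjugate_prime =
  fixes N p m n :: nat
  assumes N_eq: "N = p * m" and m_pos: "m > 0" and prime_p: "prime p"
    and not_dvd_m: "\<not> p dvd m" and n_pos: "n > 0" and m_dvd: "m dvd p ^ n + 1"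
begin

abbreviation "R \<equiv> int_adjoin (zeta N)"
abbreviation "dvd_R \<equiv> adjoin_dvd (zeta N)"
abbreviation "\<xi> \<equiv> zeta N ^ m"
abbreviation "\<pi> \<equiv> 1 - \<xi>"

lemma N_pos: "N > 0"
  using prime_p m_pos by (simp add: N_eq prime_gt_0_nat)

lemma \<xi>_in_R: "\<xi> \<in> R" and \<pi>_in_R: "\<pi> \<in> R"
  by (intro int_adjoin_closed)+

lemma \<xi>_power_p: "\<xi> ^ p = 1"
  using N_pos by (simp add: zeta_power_eq_1_iff N_eq flip: power_mult)

lemma \<pi>_nonzero: "\<pi> \<noteq> 0"
  using N_pos m_pos prime_gt_1_nat[OF prime_p]
  by (auto simp: zeta_power_eq_1_iff N_eq dest: dvd_imp_le)

text \<open>The powers of \<xi> sum to 0, so p is the sum of all 1 - \<xi>^i, each a multiple of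
  \<pi>.\<close>

lemma \<pi>_dvd_p: "dvd_R \<pi> (of_nat p)"
proof -
  have "(\<Sum>i<p. \<xi> ^ i) = 0"
    using \<pi>_nonzero \<xi>_power_p by (simp add: geometric_sum)
  then have "of_nat p = (\<Sum>i<p. 1 ^ i - \<xi> ^ i)"
    by (simp add: sum_subtractf)
  also have "dvd_R \<pi> \<dots>"
    by (intro adjoin_dvd_sum adjoin_dvd_diff_power adjoin_dvd_refl int_adjoin_closed)
  finally show ?thesis .
qed

text \<open>Frobenius modulo p applied to 1 = \<pi> + \<xi> gives that 1 is congruent to \<pi>^p +
  1.\<close>

lemma p_dvd_\<pi>_power: "dvd_R (of_nat p) (\<pi> ^ p)"
proof -
  have "dvd_R (of_nat p) ((\<pi> + \<xi>) ^ p ^ 1 - (\<pi> ^ p ^ 1 + \<xi> ^ p ^ 1))"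
    by (intro adjoin_dvd_frobenius_add prime_p adjoin_dvd_refl \<pi>_in_R \<xi>_in_R)
  then have "dvd_R (of_nat p) (- (\<pi> ^ p))"
    by (simp add: \<xi>_power_p)
  from adjoin_dvd_diff[OF adjoin_dvd_0 this] show ?thesis
    by simp
qed

lemma \<pi>_not_unit: "\<not> dvd_R \<pi> 1"
proof
  assume "dvd_R \<pi> 1"
  from adjoin_dvd_power[OF this, of p] have "dvd_R (\<pi> ^ p) 1"
    by simp
  with p_dvd_\<pi>_power have "dvd_R (of_nat p) 1"
    by (rule adjoin_dvd_trans)
  moreover have "zeta N ^ N = 1"
    using N_pos by (simp add: zeta_power_eq_1_iff)
  ultimately show False
    using prime_not_unit_int_adjoin N_pos prime_p by blast
qed

text \<open>Otherwise, by Bezout, 1 would be a combination of p and a, hence a multiple of the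
  non-unit \<pi>. This brings divisibility by \<pi> back to the integers.\<close>

lemma \<pi>_dvd_of_int:
  assumes "dvd_R \<pi> (of_int a)"
  shows "int p dvd a"
proof (rule ccontr)
  assume "\<not> int p dvd a"
  then have "coprime (int p) a"
    using prime_p by (simp add: prime_imp_coprime)
  then obtain u v where "u * int p + v * a = 1"
    using bezout_int[of "int p" a] by auto
  then have "of_int (u * int p + v * a) = (1 :: complex)"
    by (simp only: of_int_1)
  then have "1 = of_int u * of_nat p + of_int v * (of_int a :: complex)"
    by simp
  also have "dvd_R \<pi> \<dots>"
    by (intro adjoin_dvd_add adjoin_dvd_mult_left assms \<pi>_dvd_p int_adjoin_of_int)
  finally show False
    using \<pi>_not_unit by simp
qed

text \<open>
  Self-conjugacy: since \<open>p\<^sup>n \<equiv> - 1\<close> modulo \<open>m\<close>, complex conjugation acts on the residue ring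
  modulo \<open>\<pi>\<close> as a power of the Frobenius map.
\<close>
lemma frobenius_power_cong_cnj:
  assumes "z \<in> R"
  shows "dvd_R \<pi> (z ^ p ^ n - cnj z)"
  using assms
proof induction
  case (int_adjoin_of_int a)
  \<comment> \<open>For integers the claim is a form of Fermat's little theorem, proved by induction
    from 0 in both directions with Frobenius additivity for i + 1.\<close>
  have add: "dvd_R \<pi> ((of_int (i + 1)) ^ p ^ n - (of_int i ^ p ^ n + 1))" for i
    using adjoin_dvd_frobenius_add[OF prime_p \<pi>_dvd_p int_adjoin_closed(1)[of i] int_adjoin_1, of n]
    by simp
  have "dvd_R \<pi> (of_int a ^ p ^ n - of_int a)"
  proof (induction a rule: int_induct[of _ 0])
    case base
    then show ?case
      using prime_gt_0_nat[OF prime_p] by (simp add: adjoin_dvd_0 power_0_left)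
  next
    case (step1 i)
    then show ?case
      using adjoin_dvd_add[OF add[of i] step1(2)] by (simp add: algebra_simps)
  next
    case (step2 i)
    then show ?case
      using adjoin_dvd_diff[OF step2(2) add[of "i - 1"]] by (simp add: algebra_simps)
  qed
  then show ?case
    by simp
next
  case int_adjoin_generator
  obtain t where t: "p ^ n + 1 = m * t"
    using m_dvd by blast
  have "cnj (zeta N) = zeta N powi (- 1)"
    using cnj_zeta_powi[of N 1] by simp
  \<comment> \<open>As m divides p^n + 1, the factor 1 - zeta^(p^n + 1) equals 1 - \<xi>^t, a
    multiple of \<pi>.\<close>
  then have "zeta N ^ p ^ n - cnj (zeta N) = - (zeta N powi (- 1) * (1 - zeta N ^ (p ^ n + 1)))"
    using zeta_nonzero[of N] by (simp add: algebra_simps)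
  also have "\<dots> = - (zeta N powi (- 1)) * (1 ^ t - \<xi> ^ t)"
    unfolding t by (simp add: power_mult)
  also have "dvd_R \<pi> \<dots>"
    by (intro adjoin_dvd_mult_left adjoin_dvd_diff_power adjoin_dvd_refl int_adjoin_closed
        zeta_powi_in_adjoin N_pos)
  finally show ?case .
next
  case (int_adjoin_add x y)
  have "dvd_R \<pi> ((x + y) ^ p ^ n - (x ^ p ^ n + y ^ p ^ n))"
    using int_adjoin_add by (intro adjoin_dvd_frobenius_add prime_p \<pi>_dvd_p)
  from adjoin_dvd_add[OF this adjoin_dvd_add[OF int_adjoin_add.IH]] show ?case
    by (simp add: algebra_simps)
next
  case (int_adjoin_mult x y)
  have "(x * y) ^ p ^ n - cnj (x * y) =
          (x ^ p ^ n - cnj x) * y ^ p ^ n + cnj x * (y ^ p ^ n - cnj y)"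
    by (simp add: algebra_simps power_mult_distrib)
  moreover have "dvd_R \<pi> \<dots>"
    by (rule adjoin_dvd_add[OF adjoin_dvd_mult_right[OF int_adjoin_mult.IH(1)]
          adjoin_dvd_mult_left[OF int_adjoin_mult.IH(2)]])
       (intro int_adjoin_power cnj_in_adjoin_zeta int_adjoin_mult.hyps N_pos)+
  ultimately show ?case
    by simp
qed

text \<open>Let q = p^n. Modulo \<pi>, z^(q+1) is z times its conjugate, that is 0, hence z^(q^2) is
  0. But z^(q^2) is also z conjugated twice, that is z.\<close>

lemma \<pi>_dvd_if_dvd_norm:
  assumes "z \<in> R" "dvd_R \<pi> (z * cnj z)"
  shows "dvd_R \<pi> z"
proof -
  define q where "q = p ^ n"
  \<comment> \<open>Positivity of n gives q >= 2, whence q + 1 <= q^2.\<close>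
  have "q \<ge> 2 ^ n"
    using prime_ge_2_nat[OF prime_p] by (simp add: q_def power_mono)
  moreover have "(2::nat) ^ n \<ge> 2"
    using n_pos by (cases n) auto
  ultimately have "q \<ge> 2"
    by linarith
  then have "2 * q \<le> q * q"
    by simp
  then have le: "q + 1 \<le> q * q"
    using \<open>q \<ge> 2\<close> by linarith
  have cnj: "cnj z \<in> R"
    using assms N_pos by (simp add: cnj_in_adjoin_zeta)
  have frob: "dvd_R \<pi> (z ^ q - cnj z)" "dvd_R \<pi> (cnj z ^ q - z)"
    using frobenius_power_cong_cnj[OF assms(1)] frobenius_power_cong_cnj[OF cnj]
    by (simp_all add: q_def)
  have "dvd_R \<pi> ((z ^ q - cnj z) * z + z * cnj z)"
    by (intro adjoin_dvd_add adjoin_dvd_mult_right frob assms)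
  then have "dvd_R \<pi> (z ^ (q + 1))"
    by (simp add: algebra_simps)
  then have "dvd_R \<pi> (z ^ (q + 1) * z ^ (q * q - (q + 1)))"
    by (intro adjoin_dvd_mult_right int_adjoin_power assms)
  then have square: "dvd_R \<pi> (z ^ (q * q))"
    by (simp only: power_add[symmetric] le_add_diff_inverse[OF le])
  have "dvd_R \<pi> ((z ^ q) ^ q - cnj z ^ q)"
    by (intro adjoin_dvd_diff_power frob int_adjoin_power assms cnj)
  from adjoin_dvd_diff[OF square adjoin_dvd_add[OF this frob(2)]] show ?thesis
    by (simp add: power_mult)
qed

text \<open>With z = \<pi>^k x from the induction hypothesis, cancelling the k-th power of
  \<open>\<pi> * cnj \<pi>\<close> shows that \<pi> divides x times its conjugate, and hence
  x.\<close>

lemma \<pi>_power_dvd_if_dvd_norm: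
  assumes "z \<in> R" "dvd_R ((\<pi> * cnj \<pi>) ^ k) (z * cnj z)"
  shows "dvd_R (\<pi> ^ k) z"
  using assms(2)
proof (induction k)
  case 0
  then show ?case
    using assms(1) by (simp add: adjoin_dvd_def)
next
  case (Suc k)
  define \<mu> where "\<mu> = \<pi> * cnj \<pi>"
  have \<mu>: "\<mu> \<in> R" "\<mu> \<noteq> 0"
    using \<pi>_in_R cnj_in_adjoin_zeta[OF N_pos \<pi>_in_R] \<pi>_nonzero
    unfolding \<mu>_def by (auto intro: int_adjoin_mult simp del: complex_cnj_diff)
  obtain y where y: "y \<in> R" "z * cnj z = \<mu> ^ Suc k * y"
    using Suc.prems unfolding \<mu>_def adjoin_dvd_def by blast
  have "dvd_R (\<mu> ^ k) (z * cnj z)"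
    using y \<mu> unfolding adjoin_dvd_def
    by (intro bexI[of _ "\<mu> * y"]) (auto intro: int_adjoin_mult simp: mult_ac)
  then obtain x where x: "x \<in> R" "z = \<pi> ^ k * x"
    using Suc.IH unfolding \<mu>_def adjoin_dvd_def by blast
  have "\<mu> ^ k * (x * cnj x) = z * cnj z"
    unfolding x \<mu>_def by (simp add: power_mult_distrib mult_ac)
  also have "\<dots> = \<mu> ^ k * (\<mu> * y)"
    by (simp add: y mult_ac)
  finally have "x * cnj x = \<pi> * (cnj \<pi> * y)"
    using \<mu> by (simp add: \<mu>_def mult.assoc)
  then have "dvd_R \<pi> (x * cnj x)"
    unfolding adjoin_dvd_def using y cnj_in_adjoin_zeta[OF N_pos \<pi>_in_R]
    by (intro bexI[of _ "cnj \<pi> * y"] int_adjoin_mult)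
  from adjoin_dvd_mult_mono[OF adjoin_dvd_refl \<pi>_dvd_if_dvd_norm[OF x(1) this]]
  have "dvd_R (\<pi> ^ k * \<pi>) (\<pi> ^ k * x)" .
  then show ?case
    by (simp add: x mult.commute)
qed

text \<open>Write \<pi>^p = p r. The norm of r z is then divisible by the p-th power of
  \<open>\<pi> * cnj \<pi>\<close>, so p r divides r z, and r cancels. The exact power of \<pi> in p
  is thereby avoided.\<close>

lemma p_dvd_if_p2_dvd_norm:
  assumes "z \<in> R" "dvd_R (of_nat p ^ 2) (z * cnj z)"
  shows "dvd_R (of_nat p) z"
proof -
  obtain r where r: "r \<in> R" "\<pi> ^ p = of_nat p * r"
    using p_dvd_\<pi>_power by (auto simp: adjoin_dvd_def)
  obtain y where y: "y \<in> R" "z * cnj z = of_nat p ^ 2 * y"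
    using assms by (auto simp: adjoin_dvd_def)
  have "(\<pi> * cnj \<pi>) ^ p = (of_nat p * r) * cnj (of_nat p * r)"
    unfolding power_mult_distrib complex_cnj_power[symmetric] r ..
  then have "(r * z) * cnj (r * z) = (\<pi> * cnj \<pi>) ^ p * y"
    using y(2) by (simp add: power2_eq_square mult_ac)
  then have "dvd_R (\<pi> ^ p) (r * z)"
    using y r assms
    by (intro \<pi>_power_dvd_if_dvd_norm) (auto simp: adjoin_dvd_def intro: int_adjoin_mult)
  then obtain x where "x \<in> R" "r * z = r * (of_nat p * x)"
    unfolding r adjoin_dvd_def by (auto simp: mult_ac)
  moreover have "r \<noteq> 0"
    using r \<pi>_nonzero by auto
  ultimately show ?thesis
    by (auto simp: adjoin_dvd_def)
qed

end

subsection \<open>Formal duality and character sums\<close>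

text \<open>The Fourier transform of the indicator function of S.\<close>

definition char_sum :: "nat \<Rightarrow> int set \<Rightarrow> int \<Rightarrow> complex" where
  "char_sum N S y = (\<Sum>x\<in>S. zeta N powi (x * y))"

lemma char_sum_mult_cnj:
  "char_sum N S y * cnj (char_sum N S y) = (\<Sum>(s, t)\<in>S \<times> S. zeta N powi ((s - t) * y))"
proof -
  have "zeta N powi (s * y) * cnj (zeta N powi (t * y)) = zeta N powi ((s - t) * y)" for s t
    unfolding cnj_zeta_powi zeta_powi_add[symmetric] by (simp add: left_diff_distrib)
  then show ?thesis
    by (simp only: char_sum_def sum_product sum.cartesian_product cnj_sum)
qed

lemma diff_count_altdef:
  assumes "T \<subseteq> {0..<int N}" "y \<in> {0..<int N}"
  shows "diff_count N T y = card {(s, t) \<in> T \<times> T. [s - t = y] (mod int N)}"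
proof -
  have "(s \<otimes>\<^bsub>integer_mod_group N\<^esub> inv\<^bsub>integer_mod_group N\<^esub> t = y) = [s - t = y] (mod int N)"
    if "t \<in> T" for s t
  proof -
    have "t \<in> carrier (integer_mod_group N)"
      using that assms by (auto simp: carrier_integer_mod_group)
    then have "s \<otimes>\<^bsub>integer_mod_group N\<^esub> inv\<^bsub>integer_mod_group N\<^esub> t = (s - t) mod int N"
      by (simp add: mod_add_right_eq)
    then show ?thesis
      using assms(2) by (simp add: cong_def)
  qed
  then show ?thesis
    unfolding diff_count_def by (intro arg_cong[of _ _ card]) auto
qed

text \<open>The difference count is the autocorrelation of T, so its transform is the squared
  modulus of that of T: the pairs are grouped by their difference modulo N.\<close>

lemma sum_diff_count_zeta:
  assumes "N > 0" "T \<subseteq> {0..<int N}"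
  shows "(\<Sum>y\<in>{0..<int N}. of_nat (diff_count N T y) * zeta N powi (y * z)) =
           char_sum N T z * cnj (char_sum N T z)"
proof -
  have fin: "finite T"
    using assms(2) finite_subset by blast
  have "of_nat (diff_count N T y) * zeta N powi (y * z) =
          (\<Sum>(s, t) | (s, t) \<in> T \<times> T \<and> (s - t) mod int N = y. zeta N powi ((s - t) * z))"
    if "y \<in> {0..<int N}" for y
  proof -
    have "[(s - t) * z = y * z] (mod int N)" if "(s - t) mod int N = y" for s t
      using that by (auto simp: cong_def mod_mult_left_eq)
    then have "(\<Sum>(s, t) | (s, t) \<in> T \<times> T \<and> (s - t) mod int N = y. zeta N powi ((s - t) * z)) =
                 (\<Sum>(s, t) | (s, t) \<in> T \<times> T \<and> (s - t) mod int N = y. zeta N powi (y * z))"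
      by (intro sum.cong) (auto intro!: zeta_powi_cong assms)
    also have "\<dots> = of_nat (card {(s, t) \<in> T \<times> T. (s - t) mod int N = y}) * zeta N powi (y * z)"
      by (simp add: case_prod_unfold)
    finally show ?thesis
      using that by (simp add: diff_count_altdef assms cong_def)
  qed
  then have "(\<Sum>y\<in>{0..<int N}. of_nat (diff_count N T y) * zeta N powi (y * z)) =
      (\<Sum>y\<in>{0..<int N}. \<Sum>(s, t) | (s, t) \<in> T \<times> T \<and> (s - t) mod int N = y.
         zeta N powi ((s - t) * z))"
    by (intro sum.cong) auto
  also have "\<dots> = (\<Sum>(s, t)\<in>T \<times> T. zeta N powi ((s - t) * z))"
  proof -
    have "(\<lambda>(s, t). (s - t) mod int N) ` (T \<times> T) \<subseteq> {0..<int N}"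
      using assms(1) by auto
    then show ?thesis
      using sum.group[of "T \<times> T" "{0..<int N}" "\<lambda>(s, t). (s - t) mod int N"
          "\<lambda>(s, t). zeta N powi ((s - t) * z)"] fin
      by (simp add: case_prod_unfold mem_Times_iff)
  qed
  finally show ?thesis
    by (simp add: char_sum_mult_cnj)
qed

text \<open>The inverse transform of the squared modulus: after swapping sums, orthogonality keeps
  exactly the pairs with difference z.\<close>

lemma sum_norm_char_sum_zeta:
  assumes "N > 0" "S \<subseteq> {0..<int N}" "z \<in> {0..<int N}"
  shows "(\<Sum>y\<in>{0..<int N}. char_sum N S y * cnj (char_sum N S y) * zeta N powi (y * - z)) =
           of_nat (N * diff_count N S z)"
proof -
  have fin: "finite S"
    using assms(2) finite_subset by blast
  have "zeta N powi ((s - t) * y) * zeta N powi (y * - z) = zeta N powi (y * (s - t - z))" for s t y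
    unfolding zeta_powi_add[symmetric] by (simp add: algebra_simps)
  then have "(\<Sum>y\<in>{0..<int N}. char_sum N S y * cnj (char_sum N S y) * zeta N powi (y * - z)) =
          (\<Sum>y\<in>{0..<int N}. \<Sum>u\<in>S \<times> S. zeta N powi (y * (fst u - snd u - z)))"
    by (simp only: char_sum_mult_cnj sum_distrib_right case_prod_unfold)
  also have "\<dots> = (\<Sum>u\<in>S \<times> S. \<Sum>y\<in>{0..<int N}. zeta N powi (y * (fst u - snd u - z)))"
    by (rule sum.swap)
  also have "\<dots> = (\<Sum>u\<in>S \<times> S. if [fst u - snd u = z] (mod int N) then of_nat N else 0)"
    by (simp add: sum_zeta_powi assms cong_iff_dvd_diff)
  also have "\<dots> = (\<Sum>u\<in>{u \<in> S \<times> S. [fst u - snd u = z] (mod int N)}. of_nat N)"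
    using fin by (intro sum.inter_filter[symmetric]) auto
  also have "{u \<in> S \<times> S. [fst u - snd u = z] (mod int N)} =
               {(s, t) \<in> S \<times> S. [s - t = z] (mod int N)}"
    by auto
  also have "(\<Sum>u\<in>\<dots>. of_nat N) = (of_nat (N * diff_count N S z) :: complex)"
    using diff_count_altdef[OF assms(2,3)] by simp
  finally show ?thesis .
qed

text \<open>Fourier inversion for the indicator function of S.\<close>

lemma sum_char_sum_zeta:
  assumes "N > 0" "S \<subseteq> {0..<int N}" "x \<in> {0..<int N}"
  shows "(\<Sum>y\<in>{0..<int N}. char_sum N S y * zeta N powi (y * - x)) = of_nat N * of_bool (x \<in> S)"
proof -
  have fin: "finite S"
    using assms(2) finite_subset by blast
  have "zeta N powi (s * y) * zeta N powi (y * - x) = zeta N powi (y * (s - x))" for s y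
    unfolding zeta_powi_add[symmetric] by (simp add: algebra_simps)
  then have "(\<Sum>y\<in>{0..<int N}. char_sum N S y * zeta N powi (y * - x)) =
          (\<Sum>y\<in>{0..<int N}. \<Sum>s\<in>S. zeta N powi (y * (s - x)))"
    by (simp only: char_sum_def sum_distrib_right)
  also have "\<dots> = (\<Sum>s\<in>S. \<Sum>y\<in>{0..<int N}. zeta N powi (y * (s - x)))"
    by (rule sum.swap)
  also have "\<dots> = (\<Sum>s\<in>S. if s = x then of_nat N else 0)"
  proof (rule sum.cong)
    fix s assume "s \<in> S"
    then have "s \<in> {0..<int N}"
      using assms by blast
    then have "int N dvd s - x \<longleftrightarrow> s = x"
      using assms(3) cong_less_imp_eq_int[of s "int N" x] by (auto simp: cong_iff_dvd_diff)
    then show "(\<Sum>y\<in>{0..<int N}. zeta N powi (y * (s - x))) = (if s = x then of_nat N else 0)"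
      by (simp add: sum_zeta_powi assms)
  qed simp
  also have "\<dots> = of_nat N * of_bool (x \<in> S)"
    using fin by simp
  finally show ?thesis .
qed

section \<open>Symmetry of formal duality and the product of the cardinalities\<close>

text \<open>Formal duality with denominators cleared and the squared modulus written as a product,
  so that it becomes an equation in Z[\<open>zeta N\<close>].\<close>

definition norm_dual :: "nat \<Rightarrow> int set \<Rightarrow> int set \<Rightarrow> bool" where
  "norm_dual N S T \<longleftrightarrow> (\<forall>y\<in>{0..<int N}.
     of_nat (card T) * (char_sum N S y * cnj (char_sum N S y)) =
     of_nat (card S ^ 2 * diff_count N T y))"

lemma formally_dual_imp_norm_dual:
  assumes "N > 0" "formally_dual N S T"
  shows "norm_dual N S T"
  unfolding norm_dual_def
proof
  fix y assume "y \<in> {0..<int N}"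
  then have carrier: "y \<in> carrier (integer_mod_group N)"
    using assms(1) by (simp add: carrier_integer_mod_group)
  have "card S > 0" "card T > 0"
    using assms by (auto simp: formally_dual_def carrier_integer_mod_group card_gt_0_iff
        intro: finite_subset)
  then have "real (card T) * (cmod (char_sum N S y))\<^sup>2 = real (card S ^ 2 * diff_count N T y)"
    using assms(2) carrier by (auto simp: formally_dual_def char_sum_def field_simps)
  then have "complex_of_real (real (card T) * (cmod (char_sum N S y))\<^sup>2) =
               complex_of_real (real (card S ^ 2 * diff_count N T y))"
    by (rule arg_cong)
  then show "of_nat (card T) * (char_sum N S y * cnj (char_sum N S y)) =
               of_nat (card S ^ 2 * diff_count N T y)"
    by (simp only: of_real_mult complex_norm_square of_real_of_nat_eq)
qed

text \<open>The duality equation is Fourier-transformed at -z: its left side yields the difference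
  count of S, its right side the squared modulus of the transform of T.\<close>

lemma norm_dual_fourier:
  assumes "N > 0" "S \<subseteq> {0..<int N}" "T \<subseteq> {0..<int N}" "norm_dual N S T" "z \<in> {0..<int N}"
  shows "of_nat (card S ^ 2) * (char_sum N T z * cnj (char_sum N T z)) =
           of_nat (card T * N * diff_count N S z)"
proof -
  \<comment> \<open>The squared modulus therefore agrees at z and -z.\<close>
  have cnj: "char_sum N T (- z) = cnj (char_sum N T z)"
    by (simp add: char_sum_def cnj_zeta_powi del: complex_cnj_power_int)
  have "of_nat (card T * N * diff_count N S z) =
          of_nat (card T) *
          (\<Sum>y\<in>{0..<int N}. char_sum N S y * cnj (char_sum N S y) * zeta N powi (y * - z))"
    unfolding sum_norm_char_sum_zeta[OF assms(1,2,5)] by simp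
  also have "\<dots> = (\<Sum>y\<in>{0..<int N}.
      (of_nat (card T) * (char_sum N S y * cnj (char_sum N S y))) * zeta N powi (y * - z))"
    by (simp only: sum_distrib_left mult.assoc)
  also have "\<dots> = (\<Sum>y\<in>{0..<int N}.
      of_nat (card S ^ 2) * (of_nat (diff_count N T y) * zeta N powi (y * - z)))"
    using assms(4) by (intro sum.cong) (auto simp: norm_dual_def)
  also have "\<dots> = of_nat (card S ^ 2) * (char_sum N T (- z) * cnj (char_sum N T (- z)))"
    using sum_diff_count_zeta[of N T "- z"] assms by (simp only: flip: sum_distrib_left)
  finally show ?thesis
    by (simp add: cnj mult.commute)
qed

text \<open>At z = 0 the character sum of T is |T| and the difference count of S is |S|; the
  transformed equation then reads |S|^2 |T|^2 = |T| N |S|.\<close>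

lemma norm_dual_card:
  assumes "N > 0" "S \<subseteq> {0..<int N}" "S \<noteq> {}" "T \<subseteq> {0..<int N}" "T \<noteq> {}" "norm_dual N S T"
  shows "card S * card T = N"
proof -
  have fin: "finite S" "finite T"
    using assms finite_subset by blast+
  have "{(s, t) \<in> S \<times> S. [s - t = 0] (mod int N)} = (\<lambda>s. (s, s)) ` S"
  proof -
    have "s = t" if "s \<in> S" "t \<in> S" "[s - t = 0] (mod int N)" for s t
      using that assms(2) cong_less_imp_eq_int[of s "int N" t]
      by (auto simp: cong_iff_dvd_diff subset_iff)
    then show ?thesis
      by auto
  qed
  then have "diff_count N S 0 = card S"
    using assms by (simp add: diff_count_altdef card_image inj_on_def)
  then have "of_nat (card S ^ 2 * (card T * card T)) = (of_nat (card T * N * card S) :: complex)"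
    using norm_dual_fourier[of N S T 0] assms by (simp add: char_sum_def)
  then have "card S ^ 2 * (card T * card T) = card T * N * card S"
    unfolding of_nat_eq_iff .
  then show ?thesis
    using fin assms by (simp add: power2_eq_square card_gt_0_iff)
qed

text \<open>Substituting N = |S| |T| into the transformed equation and cancelling one factor |S|
  gives the duality with roles exchanged.\<close>

lemma norm_dual_swap:
  assumes "N > 0" "S \<subseteq> {0..<int N}" "S \<noteq> {}" "T \<subseteq> {0..<int N}" "T \<noteq> {}" "norm_dual N S T"
  shows "norm_dual N T S"
  unfolding norm_dual_def
proof
  fix z assume z: "z \<in> {0..<int N}"
  define X where "X = char_sum N T z * cnj (char_sum N T z)"
  have "card S \<noteq> 0"
    using assms finite_subset[of S "{0..<int N}"] by auto
  have "of_nat (card S) * (of_nat (card S) * X) = of_nat (card S ^ 2) * X"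
    by (simp add: power2_eq_square)
  also have "\<dots> = of_nat (card T * N * diff_count N S z)"
    using norm_dual_fourier assms z unfolding X_def by blast
  also have "card T * N * diff_count N S z = card S * (card T ^ 2 * diff_count N S z)"
    using norm_dual_card[OF assms] by (auto simp: power2_eq_square)
  finally show "of_nat (card S) * X = of_nat (card T ^ 2 * diff_count N S z)"
    using \<open>card S \<noteq> 0\<close> by simp
qed

section \<open>From divisibility of character sums to periodicity of S and non-primitivity of
  T\<close>

context self_conjugate_prime
begin

lemma char_sum_in_R: "char_sum N S y \<in> R"
  unfolding char_sum_def by (intro int_adjoin_sum zeta_powi_in_adjoin N_pos)

text \<open>Duality shows that p^2 divides |T| X, where X is the squared modulus; as |T| is prime to
  p, Bezout removes it.\<close>

lemma p_dvd_char_sum: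
  assumes "norm_dual N S T" "y \<in> {0..<int N}" "p dvd card S" "\<not> p dvd card T"
  shows "dvd_R (of_nat p) (char_sum N S y)"
proof (rule p_dvd_if_p2_dvd_norm[OF char_sum_in_R])
  define X where "X = char_sum N S y * cnj (char_sum N S y)"
  have X: "X \<in> R"
    unfolding X_def by (intro int_adjoin_mult cnj_in_adjoin_zeta char_sum_in_R N_pos)
  have "int (p\<^sup>2) dvd int (card S ^ 2 * diff_count N T y)"
    using assms(3) by (intro iffD2[OF int_dvd_int_iff] dvd_mult2 dvd_power_same)
  then have dvd: "dvd_R (of_nat p ^ 2) (of_nat (card T) * X)"
    using assms(1,2) adjoin_dvd_of_int unfolding norm_dual_def X_def by fastforce
  have "coprime (int (p ^ 2)) (int (card T))"
    using assms(4) prime_p by (simp add: prime_imp_coprime)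
  then obtain u v where "u * int (p ^ 2) + v * int (card T) = 1"
    using bezout_int[of "int (p ^ 2)" "int (card T)"] by auto
  then have "of_int (u * int (p ^ 2) + v * int (card T)) * X = X"
    by (simp only: of_int_1 mult_1_left)
  then have "X = of_nat p ^ 2 * (of_int u * X) + of_int v * (of_nat (card T) * X)"
    by (simp add: algebra_simps)
  moreover have "dvd_R (of_nat p ^ 2) \<dots>"
    using X by (intro adjoin_dvd_add adjoin_dvd_mult_left adjoin_dvd_mult_right dvd adjoin_dvd_refl
        int_adjoin_closed)
  ultimately show "dvd_R (of_nat p ^ 2) X"
    by simp
qed

lemma mem_shift_iff:
  assumes S: "S \<subseteq> {0..<int N}" and x: "x \<in> {0..<int N}"
    and dvd: "\<And>y. y \<in> {0..<int N} \<Longrightarrow> dvd_R (of_nat p) (char_sum N S y)"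
  shows "(x + int m) mod int N \<in> S \<longleftrightarrow> x \<in> S"
proof -
  define x' where "x' = (x + int m) mod int N"
  \<comment> \<open>d is -1, 0 or 1, so divisibility by p forces d = 0.\<close>
  define d :: int where "d = of_bool (x \<in> S) - of_bool (x' \<in> S)"
  have x': "x' \<in> {0..<int N}"
    using N_pos by (simp add: x'_def)
  have "of_nat N * of_int d =
          (\<Sum>y\<in>{0..<int N}. char_sum N S y * (zeta N powi (y * - x) - zeta N powi (y * - x')))"
    using sum_char_sum_zeta[OF N_pos S x] sum_char_sum_zeta[OF N_pos S x']
    by (simp add: d_def right_diff_distrib sum_subtractf)
  also have "dvd_R (of_nat p * \<pi>) \<dots>"
  proof (intro adjoin_dvd_sum adjoin_dvd_mult_mono dvd)
    fix y assume y: "y \<in> {0..<int N}"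
    \<comment> \<open>Translation by m multiplies the character value by a power of \<xi>, which
      provides the factor \<pi> beside the factor p from the character sum.\<close>
    have "[y * - x = y * - x' + int (m * nat y)] (mod int N)"
    proof -
      have "[y * x' = y * (x + int m)] (mod int N)"
        by (intro cong_mult cong_refl) (simp add: x'_def cong_def)
      then show ?thesis
        using y by (simp add: cong_iff_dvd_diff algebra_simps)
    qed
    then have "zeta N powi (y * - x) = zeta N powi (y * - x' + int (m * nat y))"
      using N_pos by (intro zeta_powi_cong)
    also have "\<dots> = zeta N powi (y * - x') * \<xi> ^ nat y"
      by (simp only: zeta_powi_add power_int_of_nat power_mult)
    finally have "zeta N powi (y * - x) - zeta N powi (y * - x') =
                    - (zeta N powi (y * - x')) * (1 ^ nat y - \<xi> ^ nat y)"
      by (simp add: algebra_simps)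
    also have "dvd_R \<pi> \<dots>"
      by (intro adjoin_dvd_mult_left adjoin_dvd_diff_power adjoin_dvd_refl int_adjoin_closed
          zeta_powi_in_adjoin N_pos)
    finally show "dvd_R \<pi> (zeta N powi (y * - x) - zeta N powi (y * - x'))" .
  qed
  \<comment> \<open>As N = p m, cancelling p leaves \<pi> dividing m d, with m prime to p.\<close>
  finally obtain c where "c \<in> R" "of_nat p * of_int (int m * d) = of_nat p * (\<pi> * c)"
    by (auto simp: adjoin_dvd_def N_eq mult.assoc)
  then have "dvd_R \<pi> (of_int (int m * d))"
    using prime_gt_0_nat[OF prime_p] by (auto simp: adjoin_dvd_def)
  then have "int p dvd int m * d"
    by (rule \<pi>_dvd_of_int)
  then have "int p dvd d"
    using prime_p not_dvd_m by (simp add: prime_dvd_mult_iff)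
  moreover have "\<bar>d\<bar> < int p"
    using prime_gt_1_nat[OF prime_p] by (auto simp: d_def)
  ultimately have "d = 0"
    using zdvd_not_zless[of "\<bar>d\<bar>" "int p"] by auto
  then show ?thesis
    by (auto simp: d_def x'_def of_bool_def split: if_splits)
qed

text \<open>Translation by m permutes S, so the sum is unchanged when multiplied by zeta^(m y),
  which differs from 1 as p does not divide y.\<close>

lemma char_sum_eq_0:
  assumes S: "S \<subseteq> {0..<int N}" and y: "\<not> int p dvd y"
    and shift: "\<And>x. x \<in> {0..<int N} \<Longrightarrow> (x + int m) mod int N \<in> S \<longleftrightarrow> x \<in> S"
  shows "char_sum N S y = 0"
proof -
  define f where "f x = (x + int m) mod int N" for x
  have fin: "finite S"
    using S finite_subset by blast
  have "inj_on f S"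
  proof (rule inj_onI)
    fix s t assume "s \<in> S" "t \<in> S" "f s = f t"
    then have "[s + int m = t + int m] (mod int N)"
      by (simp add: f_def cong_def)
    then have "[s = t] (mod int N)"
      by (simp add: cong_iff_dvd_diff)
    moreover have "s \<in> {0..<int N}" "t \<in> {0..<int N}"
      using S \<open>s \<in> S\<close> \<open>t \<in> S\<close> by blast+
    ultimately show "s = t"
      using cong_less_imp_eq_int[of s "int N" t] by simp
  qed
  moreover have "f ` S \<subseteq> S"
    using shift S by (auto simp: f_def)
  ultimately have "f ` S = S"
    using fin by (simp add: endo_inj_surj)
  then have "char_sum N S y = (\<Sum>x\<in>S. zeta N powi (f x * y))"
    using sum.reindex[OF \<open>inj_on f S\<close>, of "\<lambda>x. zeta N powi (x * y)"] by (simp add: char_sum_def)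
  also have "\<dots> = (\<Sum>x\<in>S. zeta N powi (x * y) * zeta N powi (int m * y))"
  proof (intro sum.cong refl)
    fix x
    have "[f x * y = (x + int m) * y] (mod int N)"
      by (intro cong_mult cong_refl) (simp add: f_def cong_def)
    then show "zeta N powi (f x * y) = zeta N powi (x * y) * zeta N powi (int m * y)"
      using zeta_powi_cong[OF N_pos] by (simp add: distrib_right zeta_powi_add)
  qed
  also have "\<dots> = char_sum N S y * zeta N powi (int m * y)"
    by (simp add: char_sum_def sum_distrib_right)
  finally have "char_sum N S y = 0 \<or> zeta N powi (int m * y) = 1"
    by simp
  moreover have "\<not> int N dvd int m * y"
    using y m_pos by (simp add: N_eq mult.commute)
  ultimately show ?thesis
    using N_pos by (simp add: zeta_powi_eq_1_iff)
qed

lemma norm_dual_imp_not_primitive: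
  assumes S: "S \<subseteq> {0..<int N}" "S \<noteq> {}" and T: "T \<subseteq> {0..<int N}" "T \<noteq> {}"
    and dual: "norm_dual N S T" and p: "p dvd card S" "\<not> p dvd card T"
  shows "\<not> primitive_subset N T"
proof
  assume prim: "primitive_subset N T"
  have fin: "finite S" "finite T"
    using S T finite_subset by blast+
  have "dvd_R (of_nat p) (char_sum N S y)" if "y \<in> {0..<int N}" for y
    using p_dvd_char_sum dual that p by blast
  then have shift: "(x + int m) mod int N \<in> S \<longleftrightarrow> x \<in> S" if "x \<in> {0..<int N}" for x
    using mem_shift_iff S(1) that by blast
  have diff: "int p dvd s - t" if "s \<in> T" "t \<in> T" for s t
  proof (rule ccontr)
    assume "\<not> int p dvd s - t"
    define y where "y = (s - t) mod int N"
    have y: "y \<in> {0..<int N}"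
      using N_pos by (simp add: y_def)
    have "int p dvd int N"
      by (simp add: N_eq)
    then have "\<not> int p dvd y"
      using \<open>\<not> int p dvd s - t\<close> by (simp add: y_def dvd_mod_iff)
    then have "char_sum N S y = 0"
      using char_sum_eq_0 S(1) shift by blast
    then have "(of_nat (card S ^ 2 * diff_count N T y) :: complex) = 0"
      using dual y by (metis mult_zero_left mult_zero_right norm_dual_def)
    then have "diff_count N T y = 0"
      using fin S by simp
    \<comment> \<open>Finiteness turns cardinality 0 into emptiness, whereas the pair (s, t) at hand
      lies in this set.\<close>
    moreover have "finite {(s, t) \<in> T \<times> T. [s - t = y] (mod int N)}"
      by (rule finite_subset[of _ "T \<times> T"]) (use fin in auto)
    ultimately show False
      using that y T by (auto simp: diff_count_altdef y_def cong_def)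
  qed
  define G where "G = integer_mod_group N"
  interpret G: group G
    by (simp add: G_def)
  have carrier: "carrier G = {0..<int N}"
    using N_pos by (simp add: G_def carrier_integer_mod_group)
  \<comment> \<open>The subgroup of index p. It is proper since it misses 1, and T lies in its coset
    through any element of T.\<close>
  define H where "H = {x \<in> {0..<int N}. int p dvd x}"
  have mod_p: "int p dvd a mod int N \<longleftrightarrow> int p dvd a" for a
    by (simp add: dvd_mod_iff N_eq)
  have "subgroup H G"
  proof (rule G.subgroupI)
    have "0 \<in> H"
      using N_pos by (simp add: H_def)
    then show "H \<noteq> {}"
      by blast
  next
    fix a assume "a \<in> H"
    then have "a \<in> carrier (integer_mod_group N)"
      using carrier by (simp add: H_def G_def)
    with \<open>a \<in> H\<close> show "inv\<^bsub>G\<^esub> a \<in> H"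
      using N_pos by (simp add: H_def G_def mod_p)
  next
    fix a b assume "a \<in> H" "b \<in> H"
    then show "a \<otimes>\<^bsub>G\<^esub> b \<in> H"
      using N_pos by (simp add: H_def G_def mod_p)
  qed (auto simp: H_def carrier)
  moreover have "H \<noteq> carrier G"
  proof -
    have "1 \<in> {0..<int N}"
      using m_pos prime_gt_1_nat[OF prime_p] by (simp add: N_eq one_less_mult less_1_mult')
    moreover have "1 \<notin> H"
      using prime_gt_1_nat[OF prime_p] by (simp add: H_def)
    ultimately show ?thesis
      unfolding carrier by blast
  qed
  moreover obtain t where t: "t \<in> T"
    using T by blast
  moreover have "T \<subseteq> H #>\<^bsub>G\<^esub> t"
  proof
    fix s assume s: "s \<in> T"
    have "(s - t) mod int N \<in> H"
      using diff[OF s t] N_pos by (simp add: H_def mod_p)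
    moreover have "s = (s - t) mod int N \<otimes>\<^bsub>G\<^esub> t"
      using s T by (auto simp: G_def mod_add_left_eq)
    ultimately show "s \<in> H #>\<^bsub>G\<^esub> t"
      by (auto simp: r_coset_def)
  qed
  moreover have "H #>\<^bsub>G\<^esub> t \<in> rcosets\<^bsub>G\<^esub> H"
    using t T carrier by (auto simp: RCOSETS_def)
  ultimately show False
    using prim unfolding primitive_subset_def G_def by blast
qed

end

section \<open>Reduction to a positive exponent and conclusion\<close>

lemma mod_int_power_eq_minus_one:
  assumes "coprime p m" "m > 0" "[mod_int_power (int m) (int p) j = - 1] (mod int m)"
  shows "\<exists>n>0. m dvd p ^ n + 1"
proof -
  have cop: "coprime (int p) (int m)"
    using assms by simp
  have "[int p ^ nat \<bar>j\<bar> = - 1] (mod int m)"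
  proof (cases "j \<ge> 0")
    case True
    then show ?thesis
      using assms by (simp add: mod_int_power_def)
  next
    case False
    define k where "k = nat (- j)"
    \<comment> \<open>For negative j, multiplying the congruence for the inverse by p^k turns it
      into one for p^k, so |j| serves as exponent in both cases.\<close>
    have "[modular_inverse (int m) (int p) ^ k * int p ^ k = 1] (mod int m)"
      using cong_pow[OF cong_modular_inverse2[OF cop], of k] by (simp add: power_mult_distrib)
    moreover have "[modular_inverse (int m) (int p) ^ k = - 1] (mod int m)"
      using assms False by (simp add: mod_int_power_def k_def)
    then have "[modular_inverse (int m) (int p) ^ k * int p ^ k = - 1 * int p ^ k] (mod int m)"
      by (rule cong_scalar_right)
    ultimately have "[- 1 * int p ^ k = 1] (mod int m)"
      using cong_sym cong_trans by blast
    then have "[- 1 * (- 1 * int p ^ k) = - 1 * 1] (mod int m)"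
      by (rule cong_scalar_left)
    then show ?thesis
      using False by (simp add: k_def)
  qed
  \<comment> \<open>Adding \<open>totient m\<close> keeps the residue and makes the exponent
    positive even for j = 0.\<close>
  moreover have "[int p ^ totient m = 1] (mod int m)"
    using euler_theorem[OF assms(1)] by (metis cong_int_iff of_nat_1 of_nat_power)
  ultimately have "[int p ^ nat \<bar>j\<bar> * int p ^ totient m = - 1 * 1] (mod int m)"
    by (rule cong_mult)
  then have "int m dvd int (p ^ (nat \<bar>j\<bar> + totient m) + 1)"
    by (simp add: cong_iff_dvd_diff power_add add.commute mult.commute)
  then show ?thesis
    using assms(2) by (intro exI[of _ "nat \<bar>j\<bar> + totient m"]) (simp only: int_dvd_int_iff, simp)
qed

theorem theorem8p3:
  fixes N p :: nat
  assumes "N > 0"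
    and "prime p"
    and "p dvd N"
    and "\<not> p\<^sup>2 dvd N"
    and "\<exists>j::int. [mod_int_power (int (N div p)) (int p) j = - 1] (mod int (N div p))"
  shows "\<not> (\<exists>S T. S \<subseteq> carrier (integer_mod_group N) \<and> T \<subseteq> carrier (integer_mod_group N) \<and>
               primitive_subset N S \<and> primitive_subset N T \<and> formally_dual N S T)"
proof
  assume "\<exists>S T. S \<subseteq> carrier (integer_mod_group N) \<and> T \<subseteq> carrier (integer_mod_group N) \<and>
               primitive_subset N S \<and> primitive_subset N T \<and> formally_dual N S T"
  then obtain S T where prim: "primitive_subset N S" "primitive_subset N T"
    and dual: "formally_dual N S T"
    by blast
  define m where "m = N div p"
  have N: "N = p * m"
    using assms(3) by (simp add: m_def)
  then have m: "m > 0" "\<not> p dvd m"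
    using assms(1,4) by (auto simp: power2_eq_square)
  then have "coprime p m"
    using assms(2) prime_imp_coprime by blast
  then obtain n where "n > 0" "m dvd p ^ n + 1"
    using assms(5) m mod_int_power_eq_minus_one unfolding m_def by blast
  then interpret self_conjugate_prime N p m n
    using N m assms(2) by unfold_locales
  have S: "S \<subseteq> {0..<int N}" "S \<noteq> {}" and T: "T \<subseteq> {0..<int N}" "T \<noteq> {}"
    using dual assms(1) by (simp_all add: formally_dual_def carrier_integer_mod_group)
  have ST: "norm_dual N S T"
    using dual assms(1) by (rule formally_dual_imp_norm_dual[rotated])
  then have TS: "norm_dual N T S"
    using norm_dual_swap S T assms(1) by blast
  have card: "card S * card T = N"
    using norm_dual_card S T assms(1) ST by blast
  \<comment> \<open>Since |S| |T| = N contains p exactly once, exactly one cardinality is divisible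
    by p. The first case contradicts primitivity of T, the second that of S.\<close>
  consider "p dvd card S" "\<not> p dvd card T" | "p dvd card T" "\<not> p dvd card S"
    using assms(2-4) card by (metis mult_dvd_mono power2_eq_square prime_dvd_multD)
  then show False
    using norm_dual_imp_not_primitive S T ST TS prim by cases blast+
qed

end
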